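(* Let $(\Omega,\mathcal{F},\mu)$ be a probability space, let $\rho_1,\rho_2:L^\infty(\mu)\to\mathbb{R}$ be convex expectations, and let $K_1,K_2\in L^\infty(\mu)$ with $0\le K_1<K_2$. If $\rho_1$ and $\rho_2$ are continuous from above, then there exist two constants $u>\max\{0,M-\rho_1(0)+1\}$ and $v>\max\{0,M-\rho_2(0)+1\}$ such that $\mathcal{G}_u$ and $\mathcal{H}_v$ are both closed under $\mu$-a.e. convergence.
   Context: A mapping $\rho:L^\infty(\mu)\to\mathbb{R}$ is a convex expectation if for all $X,Y\in L^\infty(\mu)$: (i) $X\ge Y$ implies $\rho(X)\ge\rho(Y)$; (ii) $\rho(X+c)=\rho(X)+c$ for every constant $c$; (iii) $\rho(\lambda X+(1-\lambda)Y)\le\lambda\rho(X)+(1-\lambda)\rho(Y)$ for $\lambda\in[0,1]$. It is continuous from above if $\rho(X_n)\to\rho(X)$ whenever $(X_n)_{n\ge1}\subset L^\infty(\mu)$ decreases to some $X\in L^\infty(\mu)$. $\mathcal{M}$ is the set of probability measures on $(\Omega,\mathcal{F})$ absolutely continuous with respect to $\mu$; $G_P=\frac{dP}{d\mu}$, $H_Q=\frac{dQ}{d\mu}$. The penalty function of $\rho$ is $\rho^*(P)=\sup_{X\in L^\infty(\mu)}(E_P[X]-\rho(X))\in(-\infty,+\infty]$, $P\in\mathcal{M}$. Put $\mathcal{P}=\{P\in\mathcal{M}:\rho_1^*(P)<\infty\}$, $\mathcal{Q}=\{Q\in\mathcal{M}:\rho_2^*(Q)<\infty\}$, $\mathcal{G}_c=\{G_P:P\in\mathcal{P},\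 \rho_1^*(P)\le c\}$, $\mathcal{H}_c=\{H_Q:Q\in\mathcal{Q},\ \rho_2^*(Q)\le c\}$ for a constant $c$. $M$ denotes the least (essential) upper bound of $K_1$ and $K_2$, i.e. $M=\|K_2\|_{L^\infty(\mu)}$. A set of random variables is closed under $\mu$-a.e. convergence if whenever a sequence in it converges $\mu$-a.e. to a random variable, that limit belongs to it. *)

theory Defs
  imports "HOL-Probability.Probability"
begin

text \<open>
  Elements of \<open>L\<^sup>\<infinity>(\<mu>)\<close> are represented by functions rather than by classes modulo
  \<open>\<mu>\<close>-a.e. equality, so order and convergence relations between them are meant \<open>\<mu>\<close>-a.e.
\<close>

definition Linf :: "'a measure \<Rightarrow> ('a \<Rightarrow> real) set" where
  "Linf \<mu> = {X \<in> borel_measurable \<mu>. \<exists>C. AE \<omega> in \<mu>. \<bar>X \<omega>\<bar> \<le> C}"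

definition Linf_norm :: "'a measure \<Rightarrow> ('a \<Rightarrow> real) \<Rightarrow> real" where
  "Linf_norm \<mu> X = real_of_ereal (esssup \<mu> (\<lambda>\<omega>. ereal \<bar>X \<omega>\<bar>))"

text \<open>
  The monotonicity axiom uses the a.e. order, hence it also makes \<open>\<rho>\<close> constant on
  the classes of \<open>\<mu>\<close>-a.e. equal functions. Values of \<open>\<rho>\<close> outside \<open>Linf \<mu>\<close> are irrelevant.
\<close>

definition convex_expectation :: "'a measure \<Rightarrow> (('a \<Rightarrow> real) \<Rightarrow> real) \<Rightarrow> bool" where
  "convex_expectation \<mu> \<rho> \<longleftrightarrow>
     (\<forall>X\<in>Linf \<mu>. \<forall>Y\<in>Linf \<mu>. (AE \<omega> in \<mu>. X \<omega> \<ge> Y \<omega>) \<longrightarrow> \<rho> X \<ge> \<rho> Y) \<and>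
     (\<forall>X\<in>Linf \<mu>. \<forall>c. \<rho> (\<lambda>\<omega>. X \<omega> + c) = \<rho> X + c) \<and>
     (\<forall>X\<in>Linf \<mu>. \<forall>Y\<in>Linf \<mu>. \<forall>l\<in>{0..1}.
        \<rho> (\<lambda>\<omega>. l * X \<omega> + (1 - l) * Y \<omega>) \<le> l * \<rho> X + (1 - l) * \<rho> Y)"

definition continuous_from_above :: "'a measure \<Rightarrow> (('a \<Rightarrow> real) \<Rightarrow> real) \<Rightarrow> bool" where
  "continuous_from_above \<mu> \<rho> \<longleftrightarrow>
     (\<forall>X Xs. X \<in> Linf \<mu> \<longrightarrow> (\<forall>n::nat. Xs n \<in> Linf \<mu>) \<longrightarrow>
        (AE \<omega> in \<mu>. decseq (\<lambda>n. Xs n \<omega>) \<and> (\<lambda>n. Xs n \<omega>) \<longlonglongrightarrow> X \<omega>) \<longrightarrow>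
        (\<lambda>n. \<rho> (Xs n)) \<longlonglongrightarrow> \<rho> X)"

definition ac_prob_measures :: "'a measure \<Rightarrow> 'a measure set" where
  "ac_prob_measures \<mu> = {P. prob_space P \<and> sets P = sets \<mu> \<and> absolutely_continuous \<mu> P}"

definition penalty :: "'a measure \<Rightarrow> (('a \<Rightarrow> real) \<Rightarrow> real) \<Rightarrow> 'a measure \<Rightarrow> ereal" where
  "penalty \<mu> \<rho> P = (SUP X\<in>Linf \<mu>. ereal ((\<integral>\<omega>. X \<omega> \<partial>P) - \<rho> X))"

definition finite_penalty_measures :: "'a measure \<Rightarrow> (('a \<Rightarrow> real) \<Rightarrow> real) \<Rightarrow> 'a measure set" where
  "finite_penalty_measures \<mu> \<rho> = {P \<in> ac_prob_measures \<mu>. penalty \<mu> \<rho> P < \<infinity>}"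

text \<open>
  The sets \<open>\<G>\<^sub>c\<close> (for \<open>\<rho>\<^sub>1\<close>) and \<open>\<H>\<^sub>c\<close> (for \<open>\<rho>\<^sub>2\<close>). As densities are determined only up
  to \<open>\<mu>\<close>-null sets, all real-valued versions of \<open>dP/d\<mu>\<close> are included. \<open>RN_deriv\<close> is \<open>ennreal\<close>-valued
  but finite \<open>\<mu>\<close>-a.e. here, so \<open>enn2real\<close> loses nothing.
\<close>

definition penalty_densities ::
  "'a measure \<Rightarrow> (('a \<Rightarrow> real) \<Rightarrow> real) \<Rightarrow> real \<Rightarrow> ('a \<Rightarrow> real) set" where
  "penalty_densities \<mu> \<rho> c =
     {g \<in> borel_measurable \<mu>. \<exists>P\<in>finite_penalty_measures \<mu> \<rho>.
        penalty \<mu> \<rho> P \<le> ereal c \<and> (AE \<omega> in \<mu>. g \<omega> = enn2real (RN_deriv \<mu> P \<omega>))}"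

definition closed_under_AE_convergence :: "'a measure \<Rightarrow> ('a \<Rightarrow> real) set \<Rightarrow> bool" where
  "closed_under_AE_convergence \<mu> S \<longleftrightarrow>
     (\<forall>g gs. (\<forall>n::nat. gs n \<in> S) \<longrightarrow> g \<in> borel_measurable \<mu> \<longrightarrow>
        (AE \<omega> in \<mu>. (\<lambda>n. gs n \<omega>) \<longlonglongrightarrow> g \<omega>) \<longrightarrow> g \<in> S)"

end

theory Submission
  imports Defs
begin

text \<open>
  Every sublevel set of the penalty is closed, whatever the level \<open>c\<close>. Let \<open>g\<^sub>n \<longlonglongrightarrow> g\<close> a.e., where
  \<open>g\<^sub>n\<close> is the density of \<open>P\<^sub>n\<close>. Applying \<open>E\<^sub>P[X] \<le> c + \<rho>(X)\<close> to \<open>X = l * 1\<^sub>B\<close> gives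
  \<open>P\<^sub>n(B) \<le> (c + \<rho>(l * 1\<^sub>B)) / l\<close>; continuity from above along \<open>B\<^sub>k = {\<exists>m\<ge>k. g\<^sub>m > g + e}\<close>, which
  decreases to a null set, then shows that no mass is lost in the limit, so \<open>g\<close> is a probability
  density. Fatou's lemma for \<open>(X + C) * g\<^sub>n \<ge> 0\<close> transfers the penalty bound to \<open>g\<close>.
\<close>

lemma LinfI:
  assumes "X \<in> borel_measurable \<mu>" "AE \<omega> in \<mu>. \<bar>X \<omega>\<bar> \<le> C"
  shows "X \<in> Linf \<mu>"
  using assms by (auto simp: Linf_def)

lemma LinfE:
  assumes "X \<in> Linf \<mu>"
  obtains C where "X \<in> borel_measurable \<mu>" "AE \<omega> in \<mu>. \<bar>X \<omega>\<bar> \<le> C"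
  using assms by (auto simp: Linf_def)

lemma integrable_Linf_mult:
  assumes "X \<in> Linf \<mu>" "integrable \<mu> g"
  shows "integrable \<mu> (\<lambda>\<omega>. X \<omega> * g \<omega>)"
proof -
  obtain C where [measurable]: "X \<in> borel_measurable \<mu>" and C: "AE \<omega> in \<mu>. \<bar>X \<omega>\<bar> \<le> C"
    using assms(1) by (rule LinfE)
  have [measurable]: "g \<in> borel_measurable \<mu>"
    using assms(2) by auto
  show ?thesis
  proof (rule Bochner_Integration.integrable_bound)
    show "integrable \<mu> (\<lambda>\<omega>. C * g \<omega>)"
      using assms(2) by simp
    show "AE \<omega> in \<mu>. norm (X \<omega> * g \<omega>) \<le> norm (C * g \<omega>)"
      using C by eventually_elim (auto simp: abs_mult intro!: mult_right_mono)
  qed simp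
qed

lemma penalty_le_iff:
  "penalty \<mu> \<rho> P \<le> ereal c \<longleftrightarrow> (\<forall>X\<in>Linf \<mu>. (\<integral>\<omega>. X \<omega> \<partial>P) \<le> c + \<rho> X)"
  by (auto simp: penalty_def SUP_le_iff algebra_simps)

text \<open>Removes \<open>P\<close> and \<open>RN_deriv\<close> from the picture, so that
  closedness becomes a question about integrals under \<open>\<mu>\<close> only. By Radon-Nikodym
  the measures involved are exactly \<open>density \<mu> g\<close> with \<open>g\<close> of mass 1,
  and the expectation of \<open>X\<close> under such a measure is the integral of
  \<open>X * g\<close>.\<close>

lemma mem_penalty_densities_iff:
  assumes "prob_space \<mu>"
  shows "g \<in> penalty_densities \<mu> \<rho> c \<longleftrightarrow>
    (AE \<omega> in \<mu>. 0 \<le> g \<omega>) \<and> integrable \<mu> g \<and> (\<integral>\<omega>. g \<omega> \<partial>\<mu>) = 1 \<and>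
    (\<forall>X\<in>Linf \<mu>. (\<integral>\<omega>. X \<omega> * g \<omega> \<partial>\<mu>) \<le> c + \<rho> X)"
    (is "_ \<longleftrightarrow> ?R")
proof
  interpret prob_space \<mu> by fact
  assume "g \<in> penalty_densities \<mu> \<rho> c"
  then obtain P where [measurable]: "g \<in> borel_measurable \<mu>"
    and P: "prob_space P" "sets P = sets \<mu>" "absolutely_continuous \<mu> P"
    and pen: "penalty \<mu> \<rho> P \<le> ereal c"
    and g: "AE \<omega> in \<mu>. g \<omega> = enn2real (RN_deriv \<mu> P \<omega>)"
    by (auto simp: penalty_densities_def finite_penalty_measures_def ac_prob_measures_def)
  interpret P: prob_space P by fact
  have nonneg: "AE \<omega> in \<mu>. 0 \<le> g \<omega>"
    using g by eventually_elim simp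
  \<comment> \<open>\<open>enn2real\<close> sends infinity to 0, so \<open>g\<close> determines
    \<open>P\<close> only once the derivative is known to be finite a.e.; this follows from
    sigma-finiteness of \<open>P\<close>.\<close>
  have "AE \<omega> in \<mu>. RN_deriv \<mu> P \<omega> \<noteq> \<infinity>"
    using RN_deriv_finite[OF P.sigma_finite_measure_axioms P(3,2)] .
  with g have "AE \<omega> in \<mu>. RN_deriv \<mu> P \<omega> = ennreal (g \<omega>)"
    by eventually_elim (simp add: top.not_eq_extremum)
  then have P_eq: "P = density \<mu> (\<lambda>\<omega>. ennreal (g \<omega>))"
    using density_RN_deriv[OF P(3,2)] density_cong[of "RN_deriv \<mu> P" \<mu> "\<lambda>\<omega>. ennreal (g \<omega>)"]
    by simp
  have "(\<integral>\<^sup>+\<omega>. ennreal (g \<omega>) \<partial>\<mu>) = emeasure P (space P)"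
    by (subst (1 2) P_eq) (simp add: emeasure_density cong: nn_integral_cong)
  then have nn: "(\<integral>\<^sup>+\<omega>. ennreal (g \<omega>) \<partial>\<mu>) = ennreal 1"
    using P.emeasure_space_1 by simp
  have "integrable \<mu> g \<and> (\<integral>\<omega>. g \<omega> \<partial>\<mu>) = 1"
    using nn_integral_eq_integrable[of g \<mu> 1] nonneg nn by simp
  moreover have "(\<integral>\<omega>. X \<omega> * g \<omega> \<partial>\<mu>) \<le> c + \<rho> X" if X: "X \<in> Linf \<mu>" for X
  proof -
    have "X \<in> borel_measurable \<mu>"
      using X by (auto simp: Linf_def)
    then have "(\<integral>\<omega>. X \<omega> \<partial>P) = (\<integral>\<omega>. X \<omega> * g \<omega> \<partial>\<mu>)"
      using nonneg by (subst P_eq) (simp add: integral_density mult.commute)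
    then show ?thesis
      using pen X by (auto simp: penalty_le_iff)
  qed
  ultimately show ?R
    using nonneg by blast
next
  interpret prob_space \<mu> by fact
  assume R: ?R
  then have nonneg: "AE \<omega> in \<mu>. 0 \<le> g \<omega>" and [measurable]: "g \<in> borel_measurable \<mu>"
    by auto
  define P where "P = density \<mu> (\<lambda>\<omega>. ennreal (g \<omega>))"
  have "(\<integral>\<^sup>+\<omega>. ennreal (g \<omega>) \<partial>\<mu>) = 1"
    using R by (simp add: nn_integral_eq_integral)
  then have "prob_space P"
    by (intro prob_spaceI) (simp add: P_def emeasure_density cong: nn_integral_cong)
  moreover have "absolutely_continuous \<mu> P"
    unfolding P_def by (rule absolutely_continuousI_density) simp
  moreover have "sets P = sets \<mu>"
    by (simp add: P_def)
  moreover have "penalty \<mu> \<rho> P \<le> ereal c"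
    unfolding penalty_le_iff
  proof
    fix X assume X: "X \<in> Linf \<mu>"
    then have "X \<in> borel_measurable \<mu>"
      by (auto simp: Linf_def)
    then have "(\<integral>\<omega>. X \<omega> \<partial>P) = (\<integral>\<omega>. X \<omega> * g \<omega> \<partial>\<mu>)"
      unfolding P_def using nonneg by (simp add: integral_density mult.commute)
    then show "(\<integral>\<omega>. X \<omega> \<partial>P) \<le> c + \<rho> X"
      using R X by auto
  qed
  moreover from this have "penalty \<mu> \<rho> P < \<infinity>"
    by (rule order.strict_trans1) simp
  \<comment> \<open>Uniqueness of the derivative identifies it with
    \<open>ennreal (g \<omega>)\<close>; as \<open>ennreal\<close> truncates negative values to 0,
    nonnegativity is what recovers \<open>g\<close> itself.\<close>
  moreover have "AE \<omega> in \<mu>. g \<omega> = enn2real (RN_deriv \<mu> P \<omega>)"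
  proof -
    have "AE \<omega> in \<mu>. ennreal (g \<omega>) = RN_deriv \<mu> P \<omega>"
      by (rule RN_deriv_unique) (simp_all add: P_def)
    with nonneg show ?thesis
      by eventually_elim (metis enn2real_ennreal)
  qed
  ultimately show "g \<in> penalty_densities \<mu> \<rho> c"
    unfolding penalty_densities_def finite_penalty_measures_def ac_prob_measures_def by auto
qed

text \<open>Fatou's lemma for \<open>ennreal\<close> integrals, carried back to real ones.
  Nonnegativity and the common bound \<open>r\<close> take the place of a dominating function and
  also yield integrability of the limit. It serves for the mass of the limit density and for its
  penalty bound.\<close>

lemma Fatou_real:
  fixes hs :: "nat \<Rightarrow> 'a \<Rightarrow> real"
  assumes [measurable]: "h \<in> borel_measurable M"
    and int: "\<And>n. integrable M (hs n)"
    and nonneg: "\<And>n. AE x in M. 0 \<le> hs n x"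
    and lim: "AE x in M. (\<lambda>n. hs n x) \<longlonglongrightarrow> h x"
    and le: "\<And>n. (\<integral>x. hs n x \<partial>M) \<le> r"
  shows "integrable M h" "(\<integral>x. h x \<partial>M) \<le> r"
proof -
  have [measurable]: "\<And>n. hs n \<in> borel_measurable M"
    using int by auto
  have "AE x in M. \<forall>n. 0 \<le> hs n x"
    using nonneg by (simp add: AE_all_countable)
  with lim have h0: "AE x in M. 0 \<le> h x"
    by eventually_elim (auto intro: LIMSEQ_le_const)
  \<comment> \<open>\<open>ennreal\<close> identifies all negative reals with 0, so the final
    comparison with \<open>ennreal r\<close> can be read in the reals only for nonnegative
    \<open>r\<close>.\<close>
  have r0: "0 \<le> r"
    using integral_nonneg_AE[OF nonneg] le[of 0] by (meson order_trans)
  have "(\<integral>\<^sup>+x. ennreal (h x) \<partial>M) = (\<integral>\<^sup>+x. liminf (\<lambda>n. ennreal (hs n x)) \<partial>M)"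
    using lim
    by (intro nn_integral_cong_AE, eventually_elim)
       (auto intro!: lim_imp_Liminf[symmetric] tendsto_ennrealI)
  also have "\<dots> \<le> liminf (\<lambda>n. \<integral>\<^sup>+x. ennreal (hs n x) \<partial>M)"
    by (rule nn_integral_liminf) simp
  also have "\<dots> = liminf (\<lambda>n. ennreal (\<integral>x. hs n x \<partial>M))"
    using int nonneg by (simp add: nn_integral_eq_integral)
  also have "\<dots> \<le> liminf (\<lambda>n::nat. ennreal r)"
    using le by (intro Liminf_mono always_eventually allI ennreal_leI)
  also have "\<dots> = ennreal r"
    by (simp add: Liminf_const)
  finally have nn: "(\<integral>\<^sup>+x. ennreal (h x) \<partial>M) \<le> ennreal r" .
  then show int_h: "integrable M h"
    using h0 by (intro integrableI_nonneg) (auto simp: order.strict_trans1)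
  show "(\<integral>x. h x \<partial>M) \<le> r"
    using nn r0 by (simp add: nn_integral_eq_integral[OF int_h h0])
qed

lemma closed_penalty_densities:
  assumes "prob_space \<mu>" and cont: "continuous_from_above \<mu> \<rho>"
  shows "closed_under_AE_convergence \<mu> (penalty_densities \<mu> \<rho> c)"
  unfolding closed_under_AE_convergence_def
proof (intro allI impI)
  interpret prob_space \<mu> by fact
  fix g gs
  assume gs: "\<forall>n::nat. gs n \<in> penalty_densities \<mu> \<rho> c"
    and g[measurable]: "g \<in> borel_measurable \<mu>"
    and lim: "AE \<omega> in \<mu>. (\<lambda>n. gs n \<omega>) \<longlonglongrightarrow> g \<omega>"
  have nonneg: "AE \<omega> in \<mu>. 0 \<le> gs n \<omega>" and int[simp]: "integrable \<mu> (gs n)"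
    and one: "(\<integral>\<omega>. gs n \<omega> \<partial>\<mu>) = 1"
    and bound: "\<And>X. X \<in> Linf \<mu> \<Longrightarrow> (\<integral>\<omega>. X \<omega> * gs n \<omega> \<partial>\<mu>) \<le> c + \<rho> X" for n
    using gs by (auto simp: mem_penalty_densities_iff[OF assms(1)])
  have [measurable]: "gs n \<in> borel_measurable \<mu>" for n
    using int[of n] by (rule borel_measurable_integrable)
  have int_g: "integrable \<mu> g" and le1: "(\<integral>\<omega>. g \<omega> \<partial>\<mu>) \<le> 1"
    using Fatou_real[OF g int nonneg lim, of 1] one by auto
  have "AE \<omega> in \<mu>. \<forall>n. 0 \<le> gs n \<omega>"
    using nonneg by (simp add: AE_all_countable)
  with lim have g0: "AE \<omega> in \<mu>. 0 \<le> g \<omega>"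
    by eventually_elim (auto intro: LIMSEQ_le_const)

  \<comment> \<open>Fatou leaves open that mass escapes onto small sets; this is the reverse of
    \<open>le1\<close> up to two errors. The term \<open>e\<close> bounds the excess of a density
    over \<open>g\<close> off an exceptional set, and the quotient by \<open>l\<close> bounds, in
    the limit, the mass on that set.\<close>
  have ge: "1 \<le> (\<integral>\<omega>. g \<omega> \<partial>\<mu>) + e + (c + \<rho> (\<lambda>_. 0)) / l" if "e > 0" "l > 0" for e l :: real
  proof -
    \<comment> \<open>Taking all indices from \<open>k\<close> on makes these sets decreasing, as
      continuity from above requires. One-sided exceedance suffices because the densities only have
      to be bounded from above.\<close>
    define B where "B k = {\<omega> \<in> space \<mu>. \<exists>m\<ge>k. gs m \<omega> > g \<omega> + e}" for k
    have [measurable]: "B k \<in> sets \<mu>" for k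
      unfolding B_def by measurable
    define X where "X k \<omega> = l * indicator (B k) \<omega>" for k \<omega>
    have X_Linf: "X k \<in> Linf \<mu>" for k
      unfolding X_def using \<open>l > 0\<close>
      by (intro LinfI[where C = l]) (auto simp: indicator_def)
    have zero: "(\<lambda>_. 0) \<in> Linf \<mu>"
      by (intro LinfI[where C = 0]) auto
    have "AE \<omega> in \<mu>. decseq (\<lambda>k. X k \<omega>) \<and> (\<lambda>k. X k \<omega>) \<longlonglongrightarrow> 0"
      using lim
    proof eventually_elim
      case (elim \<omega>)
      have "decseq (\<lambda>k. X k \<omega>)"
        using \<open>l > 0\<close> by (auto simp: decseq_def X_def B_def indicator_def) (meson order_trans)
      moreover have "\<forall>\<^sub>F m in sequentially. gs m \<omega> < g \<omega> + e"
        using elim \<open>e > 0\<close> by (intro order_tendstoD(2)) auto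
      then obtain N where N: "\<And>m. m \<ge> N \<Longrightarrow> gs m \<omega> < g \<omega> + e"
        by (auto simp: eventually_sequentially)
      have "X k \<omega> = 0" if "k \<ge> N" for k
      proof -
        have "\<omega> \<notin> B k"
          using N that unfolding B_def by (blast intro: order_trans dest: less_asym)
        then show ?thesis
          by (simp add: X_def)
      qed
      then have "(\<lambda>k. X k \<omega>) \<longlonglongrightarrow> 0"
        by (intro tendsto_eventually) (auto simp: eventually_sequentially)
      ultimately show ?case
        by blast
    qed
    then have "(\<lambda>k. \<rho> (X k)) \<longlonglongrightarrow> \<rho> (\<lambda>_. 0)"
      using cont zero X_Linf unfolding continuous_from_above_def by blast
    then have lim_\<rho>: "(\<lambda>k. (\<integral>\<omega>. g \<omega> \<partial>\<mu>) + e + (c + \<rho> (X k)) / l)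
        \<longlonglongrightarrow> (\<integral>\<omega>. g \<omega> \<partial>\<mu>) + e + (c + \<rho> (\<lambda>_. 0)) / l"
      using \<open>l > 0\<close> by (intro tendsto_intros) auto
    have "1 \<le> (\<integral>\<omega>. g \<omega> \<partial>\<mu>) + e + (c + \<rho> (X k)) / l" for k
    proof -
      have int_X: "integrable \<mu> (\<lambda>\<omega>. X k \<omega> * gs k \<omega>)"
        by (rule integrable_Linf_mult[OF X_Linf int])
      \<comment> \<open>The index \<open>k\<close> itself is among those defining
        \<open>B k\<close>. Off \<open>B k\<close> this gives
        \<open>gs k \<omega> \<le> g \<omega> + e\<close>; on \<open>B k\<close> the last term
        equals \<open>gs k \<omega>\<close>, and the rest is nonnegative.\<close>
      have "AE \<omega> in \<mu>. gs k \<omega> \<le> g \<omega> + e + X k \<omega> * gs k \<omega> / l"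
        using g0 AE_space
      proof eventually_elim
        case (elim \<omega>)
        then show ?case
          using \<open>e > 0\<close> \<open>l > 0\<close> by (cases "\<omega> \<in> B k") (auto simp: X_def B_def not_less)
      qed
      then have "(\<integral>\<omega>. gs k \<omega> \<partial>\<mu>) \<le> (\<integral>\<omega>. g \<omega> + e + X k \<omega> * gs k \<omega> / l \<partial>\<mu>)"
        using int_g int_X by (intro integral_mono_AE) auto
      also have "\<dots> = (\<integral>\<omega>. g \<omega> \<partial>\<mu>) + e + (\<integral>\<omega>. X k \<omega> * gs k \<omega> \<partial>\<mu>) / l"
        using int_g int_X by (simp add: prob_space)
      also have "\<dots> \<le> (\<integral>\<omega>. g \<omega> \<partial>\<mu>) + e + (c + \<rho> (X k)) / l"
        using bound[OF X_Linf] \<open>l > 0\<close> by (intro add_left_mono divide_right_mono) auto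
      finally show ?thesis
        by (simp add: one)
    qed
    then show ?thesis
      using LIMSEQ_le_const[OF lim_\<rho>] by blast
  qed
  \<comment> \<open>The choice \<open>e = inverse l\<close> lets both errors vanish in the single
    limit of \<open>l\<close> to infinity.\<close>
  have "((\<lambda>l. (\<integral>\<omega>. g \<omega> \<partial>\<mu>) + inverse l + (c + \<rho> (\<lambda>_. 0)) * inverse l)
      \<longlongrightarrow> (\<integral>\<omega>. g \<omega> \<partial>\<mu>) + 0 + (c + \<rho> (\<lambda>_. 0)) * 0) at_top"
    by (intro tendsto_intros tendsto_inverse_0_at_top filterlim_ident)
  moreover have "\<forall>\<^sub>F l :: real in at_top.
      1 \<le> (\<integral>\<omega>. g \<omega> \<partial>\<mu>) + inverse l + (c + \<rho> (\<lambda>_. 0)) * inverse l"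
    using eventually_gt_at_top[of 0]
    by eventually_elim (use ge in \<open>simp add: divide_inverse\<close>)
  ultimately have "1 \<le> (\<integral>\<omega>. g \<omega> \<partial>\<mu>) + 0 + (c + \<rho> (\<lambda>_. 0)) * 0"
    by (intro tendsto_lowerbound[where F = at_top]) auto
  with le1 have g1: "(\<integral>\<omega>. g \<omega> \<partial>\<mu>) = 1"
    by simp

  have "(\<integral>\<omega>. X \<omega> * g \<omega> \<partial>\<mu>) \<le> c + \<rho> X" if X: "X \<in> Linf \<mu>" for X
  proof -
    obtain C where [measurable]: "X \<in> borel_measurable \<mu>" and C: "AE \<omega> in \<mu>. \<bar>X \<omega>\<bar> \<le> C"
      using X by (rule LinfE)
    have split: "(\<integral>\<omega>. X \<omega> * f \<omega> + C * f \<omega> \<partial>\<mu>) = (\<integral>\<omega>. X \<omega> * f \<omega> \<partial>\<mu>) + C * (\<integral>\<omega>. f \<omega> \<partial>\<mu>)"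
      if "integrable \<mu> f" for f
      using that integrable_Linf_mult[OF X that] by simp
    \<comment> \<open>Adding \<open>C\<close> to \<open>X\<close> produces the nonnegative
      integrands that Fatou needs. Each \<open>gs n\<close> has mass 1, so the shift raises the
      bound by exactly \<open>C\<close>; since \<open>g\<close> has mass 1 as well, by
      \<open>g1\<close>, the two shifts cancel. A loss of mass would break this step.\<close>
    have "(\<integral>\<omega>. X \<omega> * g \<omega> + C * g \<omega> \<partial>\<mu>) \<le> c + \<rho> X + C"
    proof (rule Fatou_real(2))
      show "integrable \<mu> (\<lambda>\<omega>. X \<omega> * gs n \<omega> + C * gs n \<omega>)" for n
        using integrable_Linf_mult[OF X int] by simp
      show "AE \<omega> in \<mu>. 0 \<le> X \<omega> * gs n \<omega> + C * gs n \<omega>" for n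
        using nonneg[of n] C
        by eventually_elim (simp flip: distrib_right add: abs_le_iff)
      show "AE \<omega> in \<mu>. (\<lambda>n. X \<omega> * gs n \<omega> + C * gs n \<omega>) \<longlonglongrightarrow> X \<omega> * g \<omega> + C * g \<omega>"
        using lim by eventually_elim (intro tendsto_intros)
      show "(\<integral>\<omega>. X \<omega> * gs n \<omega> + C * gs n \<omega> \<partial>\<mu>) \<le> c + \<rho> X + C" for n
        using bound[OF X, of n] by (simp add: split one)
    qed simp
    then show ?thesis
      by (simp add: split int_g g1)
  qed
  then show "g \<in> penalty_densities \<mu> \<rho> c"
    using g0 int_g g1 by (auto simp: mem_penalty_densities_iff[OF assms(1)])
qed

theorem proposition6p2:
  fixes \<mu> :: "'a measure"
    and \<rho>1 \<rho>2 :: "('a \<Rightarrow> real) \<Rightarrow> real"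
    and K1 K2 :: "'a \<Rightarrow> real"
  assumes "prob_space \<mu>"
    and "convex_expectation \<mu> \<rho>1"
    and "convex_expectation \<mu> \<rho>2"
    and "K1 \<in> Linf \<mu>" and "K2 \<in> Linf \<mu>"
    and "AE \<omega> in \<mu>. 0 \<le> K1 \<omega> \<and> K1 \<omega> < K2 \<omega>"
    and "continuous_from_above \<mu> \<rho>1"
    and "continuous_from_above \<mu> \<rho>2"
  shows "\<exists>u v. u > max 0 (Linf_norm \<mu> K2 - \<rho>1 (\<lambda>_. 0) + 1)
             \<and> v > max 0 (Linf_norm \<mu> K2 - \<rho>2 (\<lambda>_. 0) + 1)
             \<and> closed_under_AE_convergence \<mu> (penalty_densities \<mu> \<rho>1 u)
             \<and> closed_under_AE_convergence \<mu> (penalty_densities \<mu> \<rho>2 v)"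
proof -
  \<comment> \<open>Closedness holds at every level, so any real above the prescribed threshold is a
    witness.\<close>
  have "\<exists>u. u > max 0 (Linf_norm \<mu> K2 - \<rho> (\<lambda>_. 0) + 1)
      \<and> closed_under_AE_convergence \<mu> (penalty_densities \<mu> \<rho> u)"
    if "continuous_from_above \<mu> \<rho>" for \<rho>
    using closed_penalty_densities[OF \<open>prob_space \<mu>\<close> that] gt_ex by blast
  then show ?thesis
    using assms(7,8) by blast
qed

end
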